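(* Let $m,n\ge 2$ and $\lambda_2\ge 1$ be integers. Suppose there exists an affine resolvable semi-regular group divisible (ARSRGD) design with $m$ groups of size $n$ and parameters $$v=b=mn,\quad r=k=m,\quad \lambda_1=0,\quad \lambda_2.$$ Then there exists a full pairwise additive BIB design (full PAB) with parameters $$v^\ast=m=n\lambda_2,\quad b^\ast=(m-1)n,\quad r^\ast=m-1,\quad k^\ast=\lambda_2,\quad \lambda^\ast=\lambda_2-1.$$
   Context: Block designs. A block design BD$(v,b,r,k)$ consists of a set $V$ of $v$ points and a family (repetitions allowed) of $b$ blocks, each block being a set of $k$ different points, such that each point lies in exactly $r$ blocks. Its incidence matrix is the $v\times b$ $(0,1)$-matrix whose $(i,j)$ entry is $1$ if and only if the $i$-th point lies in the $j$-th block. A BD$(v,b,r,k)$ is a balanced incomplete block (BIB) design BIBD$(v,b,r,k,\lambda)$ if any two different points lie together in exactly $\lambda$ blocks. (The degenerate cases $k=1$, $\lambda=0$ and $k=v$ are allowed.) Pairwise additive BIB designs. A PAB$(\ell;v,k,\lambda)$, with associated $b$ and $r$, is a set of $\ell$ matrices $N_1,\dots,N_\ell$ of size $v\times b$, $N_h=(a^{(h)}_{ij})$, such that each $N_h$ is the incidence matrix of a BIBD$(v,b,r,k,\lambda)$, $a^{(h_1)}_{ij}a^{(h_2)}_{ij}=0$ for all $i,j$ and all distinct $h_1,h_2$, and for all distinct $h_1,h_2$ the matrix $N_{h_1}+N_{h_2}$ is the incidence matrix of a BIBD with parameters $(v,\,b,\,2r,\,2k,\,2r(2k-1)/(v-1))$.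 A full PAB with parameters $v,b,r,k,\lambda$ is a PAB$(\ell;v,k,\lambda)$ (with these $b$ and $r$) for which $\ell=v/k$. Group divisible designs. A BD$(v,b,r,k)$ with $v=mn$ is a group divisible design with parameters $\lambda_1,\lambda_2$ if the points are partitioned into $m$ groups of $n$ points such that any two different points in the same group lie together in exactly $\lambda_1$ blocks and any two points from different groups lie together in exactly $\lambda_2$ blocks. It is semi-regular if $r-\lambda_1>0$ and $rk-v\lambda_2=0$. A BD$(v,b,r,k)$ is resolvable if its $b$ blocks can be partitioned into $r$ resolution sets of $b/r=v/k$ blocks each such that every point occurs exactly once in each resolution set. A resolvable design is affine resolvable if, for such a partition, every two blocks belonging to different resolution sets intersect in the same number $q$ of points, where for a group divisible design $q=k\lambda_2/r$. An ARSRGD design is a semi-regular group divisible design that is affine resolvable. *)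

theory Defs
  imports "Jordan_Normal_Form.Matrix" "HOL-Library.Disjoint_Sets"
begin

(* The family of blocks is a list, so that repeated blocks are told apart by their position. *)
definition block_design :: "'a set \<Rightarrow> 'a set list \<Rightarrow> nat \<Rightarrow> nat \<Rightarrow> nat \<Rightarrow> nat \<Rightarrow> bool" where
  "block_design V Bs v b r k \<longleftrightarrow>
     finite V \<and> card V = v \<and> length Bs = b \<and>
     (\<forall>B\<in>set Bs. B \<subseteq> V \<and> card B = k) \<and>
     (\<forall>x\<in>V. card {j. j < length Bs \<and> x \<in> Bs ! j} = r)"

definition common_blocks :: "'a set list \<Rightarrow> 'a \<Rightarrow> 'a \<Rightarrow> nat" where
  "common_blocks Bs x y = card {j. j < length Bs \<and> x \<in> Bs ! j \<and> y \<in> Bs ! j}"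

definition BIBD :: "'a set \<Rightarrow> 'a set list \<Rightarrow> nat \<Rightarrow> nat \<Rightarrow> nat \<Rightarrow> nat \<Rightarrow> nat \<Rightarrow> bool" where
  "BIBD V Bs v b r k l \<longleftrightarrow>
     block_design V Bs v b r k \<and>
     (\<forall>x\<in>V. \<forall>y\<in>V. x \<noteq> y \<longrightarrow> common_blocks Bs x y = l)"

definition incidence_matrix :: "'a list \<Rightarrow> 'a set list \<Rightarrow> int mat" where
  "incidence_matrix ps Bs =
     mat (length ps) (length Bs) (\<lambda>(i, j). if ps ! i \<in> Bs ! j then 1 else 0)"

(* The list ps fixes the order of the points. Taking natural numbers as points loses no
   generality, since the point set is finite. *)
definition BIBD_incidence_matrix :: "int mat \<Rightarrow> nat \<Rightarrow> nat \<Rightarrow> nat \<Rightarrow> nat \<Rightarrow> nat \<Rightarrow> bool" where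
  "BIBD_incidence_matrix N v b r k l \<longleftrightarrow>
     (\<exists>(ps :: nat list) Bs. distinct ps \<and> BIBD (set ps) Bs v b r k l \<and>
        N = incidence_matrix ps Bs)"

definition PAB :: "int mat set \<Rightarrow> nat \<Rightarrow> nat \<Rightarrow> nat \<Rightarrow> nat \<Rightarrow> nat \<Rightarrow> nat \<Rightarrow> bool" where
  "PAB Ns ell v b r k l \<longleftrightarrow>
     finite Ns \<and> card Ns = ell \<and>
     (\<forall>N\<in>Ns. BIBD_incidence_matrix N v b r k l) \<and>
     (\<forall>N\<in>Ns. \<forall>M\<in>Ns. N \<noteq> M \<longrightarrow>
        (\<forall>i<v. \<forall>j<b. N $$ (i, j) * M $$ (i, j) = 0) \<and>
        (\<exists>l'. rat_of_nat l' = 2 * rat_of_nat r * (2 * rat_of_nat k - 1) / (rat_of_nat v - 1) \<and>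
           BIBD_incidence_matrix (N + M) v b (2 * r) (2 * k) l'))"

definition full_PAB :: "int mat set \<Rightarrow> nat \<Rightarrow> nat \<Rightarrow> nat \<Rightarrow> nat \<Rightarrow> nat \<Rightarrow> bool" where
  "full_PAB Ns v b r k l \<longleftrightarrow>
     (\<exists>ell. rat_of_nat ell = rat_of_nat v / rat_of_nat k \<and> PAB Ns ell v b r k l)"

definition group_divisible ::
  "'a set \<Rightarrow> 'a set list \<Rightarrow> 'a set set \<Rightarrow> nat \<Rightarrow> nat \<Rightarrow> nat \<Rightarrow> nat \<Rightarrow> nat \<Rightarrow> nat \<Rightarrow> nat \<Rightarrow> nat \<Rightarrow> bool" where
  "group_divisible V Bs Gs m n v b r k l1 l2 \<longleftrightarrow>
     block_design V Bs v b r k \<and> v = m * n \<and>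
     partition_on V Gs \<and> card Gs = m \<and> (\<forall>G\<in>Gs. card G = n) \<and>
     (\<forall>G\<in>Gs. \<forall>x\<in>G. \<forall>y\<in>G. x \<noteq> y \<longrightarrow> common_blocks Bs x y = l1) \<and>
     (\<forall>G\<in>Gs. \<forall>H\<in>Gs. G \<noteq> H \<longrightarrow> (\<forall>x\<in>G. \<forall>y\<in>H. common_blocks Bs x y = l2))"

definition semi_regular_group_divisible ::
  "'a set \<Rightarrow> 'a set list \<Rightarrow> 'a set set \<Rightarrow> nat \<Rightarrow> nat \<Rightarrow> nat \<Rightarrow> nat \<Rightarrow> nat \<Rightarrow> nat \<Rightarrow> nat \<Rightarrow> nat \<Rightarrow> bool" where
  "semi_regular_group_divisible V Bs Gs m n v b r k l1 l2 \<longleftrightarrow>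
     group_divisible V Bs Gs m n v b r k l1 l2 \<and>
     int r - int l1 > 0 \<and> int r * int k - int v * int l2 = 0"

(* Resolution sets are sets of positions in the block list. *)
definition resolution :: "'a set \<Rightarrow> 'a set list \<Rightarrow> nat \<Rightarrow> nat set set \<Rightarrow> bool" where
  "resolution V Bs r Rs \<longleftrightarrow>
     partition_on {..<length Bs} Rs \<and> card Rs = r \<and>
     (\<forall>R\<in>Rs. rat_of_nat (card R) = rat_of_nat (length Bs) / rat_of_nat r \<and>
        (\<forall>x\<in>V. \<exists>!j. j \<in> R \<and> x \<in> Bs ! j))"

definition affine_resolvable :: "'a set \<Rightarrow> 'a set list \<Rightarrow> nat \<Rightarrow> nat \<Rightarrow> bool" where
  "affine_resolvable V Bs r q \<longleftrightarrow>
     (\<exists>Rs. resolution V Bs r Rs \<and>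
        (\<forall>R\<in>Rs. \<forall>S\<in>Rs. R \<noteq> S \<longrightarrow> (\<forall>i\<in>R. \<forall>j\<in>S. card (Bs ! i \<inter> Bs ! j) = q)))"

definition ARSRGD ::
  "'a set \<Rightarrow> 'a set list \<Rightarrow> 'a set set \<Rightarrow> nat \<Rightarrow> nat \<Rightarrow> nat \<Rightarrow> nat \<Rightarrow> nat \<Rightarrow> nat \<Rightarrow> nat \<Rightarrow> nat \<Rightarrow> bool" where
  "ARSRGD V Bs Gs m n v b r k l1 l2 \<longleftrightarrow>
     semi_regular_group_divisible V Bs Gs m n v b r k l1 l2 \<and>
     (\<exists>q. rat_of_nat q = rat_of_nat k * rat_of_nat l2 / rat_of_nat r \<and>
        affine_resolvable V Bs r q)"

end

theory Submission
  imports Defs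
begin

text \<open>
  Fix one resolution set \<open>R\<close> of the ARSRGD design. As \<open>\<lambda>\<^sub>1 = 0\<close> and \<open>k = m\<close>, every block meets
  every group in exactly one point, so each block \<open>c\<close> of \<open>R\<close> may be identified with the set of
  \<open>m\<close> groups. The traces on \<open>c\<close> of the \<open>(m - 1) n\<close> blocks outside \<open>R\<close> then form a BIB design on
  the groups: two points of \<open>c\<close> share \<open>\<lambda>\<^sub>2\<close> blocks, one of which is \<open>c\<close> itself. Points of two
  different blocks of \<open>R\<close> share no block of \<open>R\<close>, and this yields additivity: pooling \<open>s\<close> blocks
  of \<open>R\<close> gives a BIB design with index \<open>s (\<lambda>\<^sub>2 - 1) + s (s - 1) \<lambda>\<^sub>2\<close>.
\<close>

section \<open>Full PABs from abstract incidences\<close>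

lemma card_nth_filter:
  assumes "distinct xs"
  shows "card {j. j < length xs \<and> P (xs ! j)} = card {x \<in> set xs. P x}"
proof -
  have "card {j. j < length xs \<and> P (xs ! j)} = length (filter P xs)"
    by (simp add: length_filter_conv_card)
  also have "\<dots> = card (set (filter P xs))"
    using assms by (metis distinct_card distinct_filter)
  finally show ?thesis by simp
qed

text \<open>In the application \<open>c\<close> is a block of the fixed resolution set,
  \<open>i\<close> numbers a group, and \<open>I c i j\<close> says that the point of
  \<open>c\<close> in group \<open>i\<close> lies on block \<open>j\<close>. Different
  \<open>j\<close> may give equal sets, hence a list along \<open>js\<close>.\<close>

definition pooled_blocks :: "nat \<Rightarrow> ('c \<Rightarrow> nat \<Rightarrow> 'b \<Rightarrow> bool) \<Rightarrow> 'c set \<Rightarrow> 'b list \<Rightarrow> nat set list" where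
  "pooled_blocks m I S js = map (\<lambda>j. {i. i < m \<and> (\<exists>c\<in>S. I c i j)}) js"

text \<open>By \<open>disj\<close> the contributions of different \<open>c\<close> never overlap, so
  every count is a sum over \<open>S\<close>, or over \<open>S \<times> S\<close> for pairs of
  points. Singletons \<open>S\<close> will give the matrices of the PAB and two-element
  \<open>S\<close> their pairwise sums.\<close>

lemma BIBD_pooled_blocks:
  fixes I :: "'c \<Rightarrow> nat \<Rightarrow> 'b \<Rightarrow> bool"
  assumes fin: "finite S" and dist: "distinct js" and l: "l \<ge> 1"
    and disj: "\<And>c d i j. \<lbrakk>c \<in> S; d \<in> S; i < m; j \<in> set js; I c i j; I d i j\<rbrakk> \<Longrightarrow> c = d"
    and size: "\<And>c j. \<lbrakk>c \<in> S; j \<in> set js\<rbrakk> \<Longrightarrow> card {i. i < m \<and> I c i j} = k"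
    and rep: "\<And>c i. \<lbrakk>c \<in> S; i < m\<rbrakk> \<Longrightarrow> card {j \<in> set js. I c i j} = r"
    and pair: "\<And>c d i i'. \<lbrakk>c \<in> S; d \<in> S; i < m; i' < m; i \<noteq> i'\<rbrakk> \<Longrightarrow>
      card {j \<in> set js. I c i j \<and> I d i' j} = (if c = d then l - 1 else l)"
  shows "BIBD {..<m} (pooled_blocks m I S js) m (length js)
    (card S * r) (card S * k) (card S * (card S * l - 1))"
proof -
  have block_card: "card {i. i < m \<and> (\<exists>c\<in>S. I c i j)} = card S * k" if j: "j \<in> set js" for j
  proof -
    have "{i. i < m \<and> (\<exists>c\<in>S. I c i j)} = (\<Union>c\<in>S. {i. i < m \<and> I c i j})" by auto
    also have "card \<dots> = (\<Sum>c\<in>S. card {i. i < m \<and> I c i j})"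
      using fin disj[OF _ _ _ j] by (intro card_UN_disjoint) auto
    also have "\<dots> = card S * k" using size[OF _ j] by simp
    finally show ?thesis .
  qed
  have rep_card: "card {j \<in> set js. \<exists>c\<in>S. I c i j} = card S * r" if i: "i < m" for i
  proof -
    have "{j \<in> set js. \<exists>c\<in>S. I c i j} = (\<Union>c\<in>S. {j \<in> set js. I c i j})" by auto
    also have "card \<dots> = (\<Sum>c\<in>S. card {j \<in> set js. I c i j})"
      using fin disj[OF _ _ i] by (intro card_UN_disjoint) auto
    also have "\<dots> = card S * r" using rep[OF _ i] by simp
    finally show ?thesis .
  qed
  have pair_card: "card {j \<in> set js. (\<exists>c\<in>S. I c i j) \<and> (\<exists>d\<in>S. I d i' j)}
      = card S * (card S * l - 1)" if i: "i < m" and i': "i' < m" and ne: "i \<noteq> i'" for i i'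
  proof -
    have "{j \<in> set js. (\<exists>c\<in>S. I c i j) \<and> (\<exists>d\<in>S. I d i' j)}
        = (\<Union>(c, d)\<in>S \<times> S. {j \<in> set js. I c i j \<and> I d i' j})" by auto
    also have "card \<dots> = (\<Sum>p\<in>S \<times> S. card (case p of (c, d) \<Rightarrow> {j \<in> set js. I c i j \<and> I d i' j}))"
    \<comment> \<open>A position \<open>j\<close> determines the pair: \<open>disj\<close> at
      \<open>i\<close> recovers \<open>c\<close>, and at \<open>i'\<close> recovers
      \<open>d\<close>.\<close>
    proof (rule card_UN_disjoint)
      show "\<forall>p\<in>S \<times> S. \<forall>q\<in>S \<times> S. p \<noteq> q \<longrightarrow>
        (case p of (c, d) \<Rightarrow> {j \<in> set js. I c i j \<and> I d i' j}) \<inter>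
        (case q of (c, d) \<Rightarrow> {j \<in> set js. I c i j \<and> I d i' j}) = {}"
        using disj[OF _ _ i] disj[OF _ _ i'] by fastforce
    qed (use fin in auto)
    also have "\<dots> = (\<Sum>c\<in>S. \<Sum>d\<in>S. card {j \<in> set js. I c i j \<and> I d i' j})"
      by (simp add: sum.cartesian_product split_def)
    also have "\<dots> = (\<Sum>c\<in>S. \<Sum>d\<in>S. if c = d then l - 1 else l)"
      using pair[OF _ _ i i' ne] by simp
    also have "\<dots> = (\<Sum>c\<in>S. card S * l - 1)"
    proof (rule sum.cong)
      fix c assume c: "c \<in> S"
      have "(\<Sum>d\<in>S. if c = d then l - 1 else l) = (l - 1) + (\<Sum>d\<in>S - {c}. l)"
        using fin c by (subst sum.remove[of _ c]) (auto intro!: sum.cong simp del: sum_constant split: if_splits)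
      also have "\<dots> = (l - 1) + (card S - 1) * l" using c fin by simp
      also have "\<dots> = card S * l - 1"
      \<comment> \<open>Truncated subtraction is harmless here: \<open>c \<in> S\<close> makes
        \<open>card S\<close> positive, and \<open>l \<ge> 1\<close>.\<close>
      proof -
        obtain s where "card S = Suc s"
          using c fin by (metis card_eq_0_iff empty_iff not0_implies_Suc)
        then show ?thesis using l by simp
      qed
      finally show "(\<Sum>d\<in>S. if c = d then l - 1 else l) = card S * l - 1" .
    qed simp
    finally show ?thesis by simp
  qed
  have rep_pos: "card {j. j < length (pooled_blocks m I S js) \<and> i \<in> pooled_blocks m I S js ! j}
      = card S * r" if i: "i < m" for i
  proof -
    have "{j. j < length (pooled_blocks m I S js) \<and> i \<in> pooled_blocks m I S js ! j}
      = {j. j < length js \<and> (\<exists>c\<in>S. I c i (js ! j))}"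
      using i by (auto simp: pooled_blocks_def)
    then show ?thesis
      using card_nth_filter[OF dist, of "\<lambda>j. \<exists>c\<in>S. I c i j"] rep_card[OF i] by simp
  qed
  have common: "common_blocks (pooled_blocks m I S js) i i' = card S * (card S * l - 1)"
    if i: "i < m" and i': "i' < m" and ne: "i \<noteq> i'" for i i'
  proof -
    have "{j. j < length (pooled_blocks m I S js) \<and> i \<in> pooled_blocks m I S js ! j
        \<and> i' \<in> pooled_blocks m I S js ! j}
      = {j. j < length js \<and> ((\<exists>c\<in>S. I c i (js ! j)) \<and> (\<exists>d\<in>S. I d i' (js ! j)))}"
      using i i' by (auto simp: pooled_blocks_def)
    then show ?thesis unfolding common_blocks_def
      using card_nth_filter[OF dist, of "\<lambda>j. (\<exists>c\<in>S. I c i j) \<and> (\<exists>d\<in>S. I d i' j)"]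
        pair_card[OF i i' ne] by simp
  qed
  show ?thesis
    unfolding BIBD_def block_design_def
    using rep_pos common block_card by (auto simp: pooled_blocks_def)
qed

text \<open>The matrices are those of the singletons \<open>{c}\<close> with
  \<open>c \<in> R\<close>; the PAB is full because \<open>m = card R * l\<close>.\<close>

lemma full_PAB_of_incidences:
  fixes I :: "'c \<Rightarrow> nat \<Rightarrow> 'b \<Rightarrow> bool"
  assumes fin: "finite R" and dist: "distinct js" and l: "l \<ge> 1" and m2: "m \<ge> 2"
    and m: "m = card R * l" and len: "length js = (m - 1) * card R"
    and disj: "\<And>c d i j. \<lbrakk>c \<in> R; d \<in> R; i < m; j \<in> set js; I c i j; I d i j\<rbrakk> \<Longrightarrow> c = d"
    and size: "\<And>c j. \<lbrakk>c \<in> R; j \<in> set js\<rbrakk> \<Longrightarrow> card {i. i < m \<and> I c i j} = l"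
    and rep: "\<And>c i. \<lbrakk>c \<in> R; i < m\<rbrakk> \<Longrightarrow> card {j \<in> set js. I c i j} = m - 1"
    and pair: "\<And>c d i i'. \<lbrakk>c \<in> R; d \<in> R; i < m; i' < m; i \<noteq> i'\<rbrakk> \<Longrightarrow>
      card {j \<in> set js. I c i j \<and> I d i' j} = (if c = d then l - 1 else l)"
  shows "\<exists>Ns. full_PAB Ns m ((m - 1) * card R) (m - 1) l (l - 1)"
proof -
  \<comment> \<open>Taking arbitrary \<open>S\<close>, not only single elements, lets the sum of two
    matrices be again some \<open>N S\<close>.\<close>
  define N where "N S = incidence_matrix [0..<m] (pooled_blocks m I S js)" for S
  have N_BIBD: "BIBD_incidence_matrix (N S) m ((m - 1) * card R)
      (card S * (m - 1)) (card S * l) (card S * (card S * l - 1))" if S: "S \<subseteq> R" for S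
  proof -
    have "BIBD {..<m} (pooled_blocks m I S js) m (length js)
      (card S * (m - 1)) (card S * l) (card S * (card S * l - 1))"
    proof (rule BIBD_pooled_blocks)
      show "finite S" using S fin by (rule finite_subset)
    qed (use S dist l disj size rep pair in \<open>auto simp: subset_iff\<close>)
    then have "BIBD (set [0..<m]) (pooled_blocks m I S js) m ((m - 1) * card R)
      (card S * (m - 1)) (card S * l) (card S * (card S * l - 1))"
      by (simp add: len atLeast0LessThan)
    then show ?thesis unfolding BIBD_incidence_matrix_def N_def
      using distinct_upt by blast
  qed
  have entry: "N S $$ (i, j) = (if \<exists>c\<in>S. I c i (js ! j) then 1 else 0)"
    if "i < m" "j < length js" for S i j
    using that by (simp add: N_def incidence_matrix_def pooled_blocks_def)
  have dims: "dim_row (N S) = m" "dim_col (N S) = length js" for S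
    by (simp_all add: N_def incidence_matrix_def pooled_blocks_def)
  have N_add: "N {c} + N {d} = N {c, d}" if "c \<in> R" "d \<in> R" "c \<noteq> d" for c d
    using disj[OF that(1,2)] that(3)
    by (intro eq_matI) (auto simp: dims entry dest: nth_mem)
  have N_mult: "N {c} $$ (i, j) * N {d} $$ (i, j) = 0"
    if "c \<in> R" "d \<in> R" "c \<noteq> d" "i < m" "j < length js" for c d i j
    using that(3-5) disj[OF that(1,2,4), of "js ! j"] by (auto simp: entry)
  \<comment> \<open>A PAB is a set of matrices, so equal ones would collapse. Column 0 separates
    them: it has \<open>l \<ge> 1\<close> ones for \<open>c\<close>, and by \<open>disj\<close> the
    matrix of \<open>d\<close> has zeros there.\<close>
  have inj: "inj_on (\<lambda>c. N {c}) R"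
  proof (rule inj_onI, rule ccontr)
    fix c d assume c: "c \<in> R" and d: "d \<in> R" and eq: "N {c} = N {d}" and ne: "c \<noteq> d"
    have "card R \<noteq> 0" using c fin by auto
    then have len_pos: "0 < length js" using m2 len by simp
    then have "card {i. i < m \<and> I c i (js ! 0)} \<noteq> 0" using size[OF c] l by simp
    then obtain i where i: "i < m" "I c i (js ! 0)"
      by (metis (mono_tags, lifting) card.empty empty_Collect_eq)
    then have "\<not> I d i (js ! 0)" using disj[OF c d i(1), of "js ! 0"] ne len_pos by auto
    then show False using entry[OF i(1) len_pos] eq i by (metis singletonD singletonI zero_neq_one)
  qed
  have "PAB ((\<lambda>c. N {c}) ` R) (card R) m ((m - 1) * card R) (m - 1) l (l - 1)"
    unfolding PAB_def
  proof (intro conjI ballI impI)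
    show "card ((\<lambda>c. N {c}) ` R) = card R" using inj by (rule card_image)
  next
    fix A assume "A \<in> (\<lambda>c. N {c}) ` R"
    then show "BIBD_incidence_matrix A m ((m - 1) * card R) (m - 1) l (l - 1)"
      using N_BIBD[of "{_}"] by auto
  next
    fix A B assume A: "A \<in> (\<lambda>c. N {c}) ` R" and B: "B \<in> (\<lambda>c. N {c}) ` R" and "A \<noteq> B"
    then obtain c d where c: "c \<in> R" "A = N {c}" and d: "d \<in> R" "B = N {d}" and ne: "c \<noteq> d"
      by blast
    show "\<forall>i<m. \<forall>j<(m - 1) * card R. A $$ (i, j) * B $$ (i, j) = 0"
      using N_mult c d ne len by simp
    have "BIBD_incidence_matrix (A + B) m ((m - 1) * card R) (2 * (m - 1)) (2 * l) (2 * (2 * l - 1))"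
      using N_BIBD[of "{c, d}"] N_add[of c d] c d ne by (simp add: numeral_2_eq_2)
    \<comment> \<open>The prescribed index has replication number \<open>m - 1\<close>, which
      cancels against the denominator and leaves the index found for
      \<open>card S = 2\<close>.\<close>
    moreover have "rat_of_nat (2 * (2 * l - 1))
      = 2 * rat_of_nat (m - 1) * (2 * rat_of_nat l - 1) / (rat_of_nat m - 1)"
    proof -
      have "rat_of_nat m - 1 \<noteq> 0" using m2 by simp
      then show ?thesis
        using m2 l by (subst nonzero_eq_divide_eq) (simp_all add: of_nat_diff algebra_simps)
    qed
    ultimately show "\<exists>l'. rat_of_nat l'
        = 2 * rat_of_nat (m - 1) * (2 * rat_of_nat l - 1) / (rat_of_nat m - 1) \<and>
        BIBD_incidence_matrix (A + B) m ((m - 1) * card R) (2 * (m - 1)) (2 * l) l'"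
      by blast
  qed (use fin in auto)
  moreover have "rat_of_nat (card R) = rat_of_nat m / rat_of_nat l" using m l by simp
  ultimately show ?thesis unfolding full_PAB_def by blast
qed

section \<open>Incidences in an ARSRGD design\<close>

text \<open>Equality in \<open>|B| \<le> m\<close>, valid for every set meeting each of the \<open>m\<close> groups at most once.\<close>

lemma partition_transversal:
  assumes part: "partition_on V Gs" and fin: "finite Gs"
    and B: "B \<subseteq> V" "card B = card Gs"
    and single: "\<And>G x y. \<lbrakk>G \<in> Gs; x \<in> G; y \<in> G; x \<in> B; y \<in> B\<rbrakk> \<Longrightarrow> x = y"
    and G: "G \<in> Gs"
  shows "\<exists>!x. x \<in> B \<and> x \<in> G"
proof -
  have "\<forall>x\<in>B. \<exists>H\<in>Gs. x \<in> H" using B(1) partition_onD1[OF part] by blast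
  \<comment> \<open>\<open>f\<close> sends a point to its group. It is injective by
    \<open>single\<close>, hence onto by equal cardinalities, so no group is missed.\<close>
  then obtain f where f: "\<And>x. x \<in> B \<Longrightarrow> f x \<in> Gs \<and> x \<in> f x" by metis
  have "inj_on f B" using f single by (metis inj_onI)
  then have "f ` B = Gs"
    using f B(2) fin by (intro card_subset_eq) (auto simp: card_image)
  then show ?thesis using G f single by blast
qed

theorem theorem3p1:
  fixes m n l2 :: nat
  assumes "m \<ge> 2" and "n \<ge> 2" and "l2 \<ge> 1"
    and "\<exists>(V :: 'a set) Bs Gs. ARSRGD V Bs Gs m n (m * n) (m * n) m m 0 l2"
  shows "m = n * l2 \<and> (\<exists>Ns. full_PAB Ns m ((m - 1) * n) (m - 1) l2 (l2 - 1))"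
proof -
  obtain V :: "'a set" and Bs Gs where D: "ARSRGD V Bs Gs m n (m * n) (m * n) m m 0 l2"
    using assms(4) by blast
  then have GD: "group_divisible V Bs Gs m n (m * n) (m * n) m m 0 l2"
    and semi: "int m * int m - int (m * n) * int l2 = 0"
    unfolding ARSRGD_def semi_regular_group_divisible_def by auto
  \<comment> \<open>Semi-regularity with r = k = m and v = mn; cancelling m gives the first
    claim.\<close>
  have "int m * int m = int m * int (n * l2)" using semi by simp
  then have m: "m = n * l2"
    using assms(1) by (metis mult_cancel_left of_nat_0_eq_iff of_nat_eq_iff not_numeral_le_zero)
  have len: "length Bs = m * n"
    and B: "\<And>j. j < m * n \<Longrightarrow> Bs ! j \<subseteq> V \<and> card (Bs ! j) = m"
    and rep: "\<And>x. x \<in> V \<Longrightarrow> card {j. j < m * n \<and> x \<in> Bs ! j} = m"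
    and part: "partition_on V Gs" and cardGs: "card Gs = m"
    and same: "\<And>G x y. \<lbrakk>G \<in> Gs; x \<in> G; y \<in> G; x \<noteq> y\<rbrakk> \<Longrightarrow> common_blocks Bs x y = 0"
    and diff: "\<And>G H x y. \<lbrakk>G \<in> Gs; H \<in> Gs; G \<noteq> H; x \<in> G; y \<in> H\<rbrakk> \<Longrightarrow> common_blocks Bs x y = l2"
    using GD unfolding group_divisible_def block_design_def by auto
  obtain q where q: "rat_of_nat q = rat_of_nat m * rat_of_nat l2 / rat_of_nat m"
    and "affine_resolvable V Bs m q"
    using D unfolding ARSRGD_def by (elim conjE exE)
  then obtain Rs where res: "resolution V Bs m Rs"
    and aff: "\<forall>R\<in>Rs. \<forall>S\<in>Rs. R \<noteq> S \<longrightarrow> (\<forall>i\<in>R. \<forall>j\<in>S. card (Bs ! i \<inter> Bs ! j) = q)"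
    unfolding affine_resolvable_def by (elim conjE exE)
  have ql: "q = l2" using q assms(1) by simp
  from res have partR: "partition_on {..<m * n} Rs" and "card Rs = m"
    and resR: "\<forall>R\<in>Rs. rat_of_nat (card R) = rat_of_nat (length Bs) / rat_of_nat m \<and>
      (\<forall>x\<in>V. \<exists>!j. j \<in> R \<and> x \<in> Bs ! j)"
    using len unfolding resolution_def by simp_all
  then have "Rs \<noteq> {}" using assms(1) by auto
  then obtain R where R: "R \<in> Rs" by blast
  have "rat_of_nat (card R) = rat_of_nat n"
    and uniq: "\<And>x. x \<in> V \<Longrightarrow> \<exists>!j. j \<in> R \<and> x \<in> Bs ! j"
    using bspec[OF resR R] len assms(1) by simp_all
  then have cardR: "card R = n" by simp
  have Rsub: "R \<subseteq> {..<m * n}" using partR R by (auto dest: partition_onD1)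
  then have finR: "finite R" by (rule finite_subset) simp
  have finGs: "finite Gs" using cardGs assms(1) by (intro card_ge_0_finite) simp
  have single: "x = y" if "G \<in> Gs" "x \<in> G" "y \<in> G" "j < m * n" "x \<in> Bs ! j" "y \<in> Bs ! j" for G x y j
    using same[OF that(1-3)] that(4-6) len by (auto simp: common_blocks_def)
  obtain g where g: "bij_betw g {..<m} Gs"
    using ex_bij_betw_nat_finite[OF finGs] cardGs by (auto simp: atLeast0LessThan)
  then have gG: "g i \<in> Gs" if "i < m" for i using that by (auto dest: bij_betwE)
  have g_inj: "i = i'" if "i < m" "i' < m" "g i = g i'" for i i'
    using g that by (auto simp: bij_betw_def inj_on_def)
  \<comment> \<open>The point where block \<open>c\<close> meets group \<open>i\<close>; the
    description is only used for \<open>c \<in> R\<close> and \<open>i < m\<close>, where it is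
    unique.\<close>
  define p where "p c i = (THE x. x \<in> Bs ! c \<and> x \<in> g i)" for c i
  have "p c i \<in> Bs ! c \<and> p c i \<in> g i" if "c \<in> R" "i < m" for c i
  proof -
    have c: "c < m * n" using that Rsub by auto
    have "\<exists>!x. x \<in> Bs ! c \<and> x \<in> g i"
      by (rule partition_transversal[OF part finGs]) (use B[OF c] cardGs single c gG that in auto)
    then show ?thesis unfolding p_def by (rule theI')
  qed
  then have pB: "p c i \<in> Bs ! c" and pg: "p c i \<in> g i" if "c \<in> R" "i < m" for c i
    using that by auto
  have pV: "p c i \<in> V" if "c \<in> R" "i < m" for c i
    using pB[OF that] B[of c] Rsub that by auto
  have p_block: "j = c" if "c \<in> R" "i < m" "j \<in> R" "p c i \<in> Bs ! j" for c i j
    using uniq[OF pV] pB that by blast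
  have p_bij: "bij_betw (p c) {..<m} (Bs ! c)" if c: "c \<in> R" for c
  proof -
    have inj: "inj_on (p c) {..<m}"
    proof (rule inj_onI)
      fix i i' assume a: "i \<in> {..<m}" "i' \<in> {..<m}" "p c i = p c i'"
      then have "p c i \<in> g i \<inter> g i'" using pg c by (metis IntI lessThan_iff)
      then have "g i = g i'"
        using a gG disjointD[OF partition_onD2[OF part], of "g i" "g i'"] by auto
      then show "i = i'" using g_inj a by simp
    qed
    have cB: "card (Bs ! c) = m" using B Rsub c by auto
    then have "finite (Bs ! c)" using assms(1) by (intro card_ge_0_finite) simp
    then have "p c ` {..<m} = Bs ! c"
      using inj pB[OF c] cB by (intro card_subset_eq) (auto simp: card_image)
    then show ?thesis using inj by (simp add: bij_betw_def)
  qed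
  define js where "js = sorted_list_of_set ({..<m * n} - R)"
  have set_js: "set js = {..<m * n} - R" by (simp add: js_def)
  have "length js = m * n - n"
    using Rsub finR cardR by (simp add: js_def card_Diff_subset)
  then have len_js: "length js = (m - 1) * card R" using cardR by (simp add: diff_mult_distrib)
  have "\<exists>Ns. full_PAB Ns m ((m - 1) * card R) (m - 1) l2 (l2 - 1)"
  proof (rule full_PAB_of_incidences[where I = "\<lambda>c i j. p c i \<in> Bs ! j", OF finR])
    show "distinct js" by (simp add: js_def)
    show "l2 \<ge> 1" "m \<ge> 2" by fact+
    show "m = card R * l2" using m cardR by simp
    show "length js = (m - 1) * card R" by fact
  next
    fix c d i j
    assume a: "c \<in> R" "d \<in> R" "i < m" "j \<in> set js" "p c i \<in> Bs ! j" "p d i \<in> Bs ! j"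
    \<comment> \<open>Block \<open>j\<close> meets group \<open>i\<close> only once, so both points
      agree; \<open>R\<close> has just one block through that point.\<close>
    then have "p c i = p d i"
      using single[OF gG[OF a(3)] pg pg] set_js by auto
    then show "c = d" using p_block[of d i c] pB[of c i] a by simp
  next
    fix c j assume c: "c \<in> R" and j: "j \<in> set js"
    \<comment> \<open>Affine resolvability enters here: \<open>j\<close> lies in another resolution
      set, so its trace on \<open>c\<close> has \<open>q = l2\<close> points.\<close>
    then obtain S where S: "S \<in> Rs" "j \<in> S" using set_js partition_onD1[OF partR] by auto
    then have "S \<noteq> R" using j set_js by auto
    then have "card (Bs ! c \<inter> Bs ! j) = l2" using aff R S c ql by blast
    moreover have "bij_betw (p c) {i. i < m \<and> p c i \<in> Bs ! j} (Bs ! c \<inter> Bs ! j)"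
      using p_bij[OF c] by (auto simp: bij_betw_def inj_on_def)
    ultimately show "card {i. i < m \<and> p c i \<in> Bs ! j} = l2"
      using bij_betw_same_card by fastforce
  next
    fix c i assume c: "c \<in> R" "i < m"
    \<comment> \<open>Of the \<open>m\<close> blocks through the point, only \<open>c\<close>
      belongs to \<open>R\<close>.\<close>
    have "{j \<in> set js. p c i \<in> Bs ! j} = {j. j < m * n \<and> p c i \<in> Bs ! j} - {c}"
      using p_block[OF c] c set_js by auto
    moreover have "c \<in> {j. j < m * n \<and> p c i \<in> Bs ! j}" using pB[OF c] c Rsub by auto
    ultimately show "card {j \<in> set js. p c i \<in> Bs ! j} = m - 1"
      using rep[OF pV[OF c]] by simp
  next
    fix c d i i' assume a: "c \<in> R" "d \<in> R" "i < m" "i' < m" "i \<noteq> i'"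
    let ?C = "{j. j < m * n \<and> p c i \<in> Bs ! j \<and> p d i' \<in> Bs ! j}"
    have "g i \<noteq> g i'" using g_inj a by blast
    then have C: "card ?C = l2"
      using diff[OF gG gG _ pg pg] a len by (simp add: common_blocks_def)
    show "card {j \<in> set js. p c i \<in> Bs ! j \<and> p d i' \<in> Bs ! j} = (if c = d then l2 - 1 else l2)"
    \<comment> \<open>A common block inside \<open>R\<close> would have to equal both
      \<open>c\<close> and \<open>d\<close>: it is \<open>c\<close> itself if they agree, and
      otherwise there is none.\<close>
    proof (cases "c = d")
      case True
      have "{j \<in> set js. p c i \<in> Bs ! j \<and> p d i' \<in> Bs ! j} = ?C - {c}"
        using p_block[of c i] a set_js by auto
      moreover have "c \<in> ?C" using pB a True Rsub by auto
      ultimately show ?thesis using C True by simp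
    next
      case False
      have "{j \<in> set js. p c i \<in> Bs ! j \<and> p d i' \<in> Bs ! j} = ?C"
        using p_block[of c i] p_block[of d i'] a False set_js by auto
      then show ?thesis using C False by simp
    qed
  qed
  then show ?thesis using m cardR by simp
qed

end
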